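(* Let $\Delta$ be a simplicial complex. If $u$ and $v$ are distinct vertices of $\Delta$ such that $\mathcal{D}(u)\subseteq \mathcal{D}(v)$, then $\Delta$ is homotopy equivalent to $\mathrm{del}_\Delta(v)$.
   Context: $\Delta$ is an abstract simplicial complex on a finite vertex set $V$ (so $\{x\}\in\Delta$ for every $x\in V$, and $\Delta$ contains the empty face). For a vertex $p$, $\mathcal{D}(p):=\{H\in\Delta : H\cup\{p\}\notin\Delta\}$. The deletion is $\mathrm{del}_\Delta(v)=\{\tau\in\Delta : v\notin\tau\}$. *)

theory Defs
  imports "HOL-Analysis.Analysis"
begin

definition abstract_simplicial_complex :: "'a set \<Rightarrow> 'a set set \<Rightarrow> bool" where
  "abstract_simplicial_complex V \<Delta> \<longleftrightarrow>
     finite V \<and>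
     {} \<in> \<Delta> \<and>
     (\<forall>\<sigma>\<in>\<Delta>. \<sigma> \<subseteq> V) \<and>
     (\<forall>\<sigma>\<in>\<Delta>. \<forall>\<tau>. \<tau> \<subseteq> \<sigma> \<longrightarrow> \<tau> \<in> \<Delta>) \<and>
     (\<forall>x\<in>V. {x} \<in> \<Delta>)"

definition non_extending_faces :: "'a set set \<Rightarrow> 'a \<Rightarrow> 'a set set" where
  "non_extending_faces \<Delta> p = {H \<in> \<Delta>. H \<union> {p} \<notin> \<Delta>}"

definition deletion :: "'a set set \<Rightarrow> 'a \<Rightarrow> 'a set set" where
  "deletion \<Delta> v = {\<tau> \<in> \<Delta>. v \<notin> \<tau>}"

text \<open>
  Points of the geometric realization are given by barycentric coordinates: a vertex
  \<open>i\<close> is the \<open>i\<close>-th unit vector and a face is the convex hull of its vertices. Since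
  coordinates vanish off the vertex set, for a finite vertex set the product topology on
  \<open>'a \<Rightarrow> real\<close> (with \<open>'a\<close> possibly infinite) induces the Euclidean topology here.
  The empty face contributes no point, as the sum of its coordinates is 0.
\<close>

definition geometric_realization :: "'a set set \<Rightarrow> ('a \<Rightarrow> real) topology" where
  "geometric_realization \<Delta> =
     subtopology (powertop_real UNIV)
       {x. (\<forall>i. 0 \<le> x i) \<and> {i. x i \<noteq> 0} \<in> \<Delta> \<and> (\<Sum>i\<in>{i. x i \<noteq> 0}. x i) = 1}"

end

theory Submission
  imports Defs
begin

text \<open>
  The hypothesis says that every face containing \<open>v\<close> stays a face when \<open>u\<close> is added to it, i.e.
  that the link of \<open>v\<close> is a cone with apex \<open>u\<close>. In barycentric coordinates one may therefore let
  the weight that a point carries at \<open>v\<close> flow linearly to \<open>u\<close>: a point with positive weight at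
  \<open>v\<close> has a support containing \<open>v\<close>, and during the flow the support grows at most by \<open>u\<close>, so the
  point never leaves the realization (\<open>transfer_mem_carrier\<close>); a point without weight at \<open>v\<close> does
  not move. At the end of the flow no weight is left at \<open>v\<close>, so that the flow is a deformation
  retraction of the realization of \<open>\<Delta>\<close> onto that of the deletion.
\<close>

definition realization_carrier :: "'a set set \<Rightarrow> ('a \<Rightarrow> real) set" where
  "realization_carrier \<Delta> =
     {x. (\<forall>i. 0 \<le> x i) \<and> {i. x i \<noteq> 0} \<in> \<Delta> \<and> (\<Sum>i\<in>{i. x i \<noteq> 0}. x i) = 1}"

definition transfer :: "'a \<Rightarrow> 'a \<Rightarrow> real \<Rightarrow> ('a \<Rightarrow> real) \<Rightarrow> 'a \<Rightarrow> real" where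
  "transfer v u t x = (\<lambda>i. x i + t * x v * (of_bool (i = u) - of_bool (i = v)))"

lemma geometric_realization_eq:
  "geometric_realization \<Delta> = subtopology (powertop_real UNIV) (realization_carrier \<Delta>)"
  unfolding geometric_realization_def realization_carrier_def ..

lemma topspace_geometric_realization [simp]:
  "topspace (geometric_realization \<Delta>) = realization_carrier \<Delta>"
  by (simp add: geometric_realization_eq)

text \<open>
  Along the flow the support changes; summing over the fixed finite set \<open>V\<close> instead lets the
  total weight be computed by linearity.
\<close>

lemma realization_carrier_iff:
  assumes "finite V" and "\<And>\<sigma>. \<sigma> \<in> \<Delta> \<Longrightarrow> \<sigma> \<subseteq> V"
  shows "x \<in> realization_carrier \<Delta> \<longleftrightarrow>
           (\<forall>i. 0 \<le> x i) \<and> {i. x i \<noteq> 0} \<in> \<Delta> \<and> sum x V = 1"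
proof -
  have "sum x {i. x i \<noteq> 0} = sum x V" if "{i. x i \<noteq> 0} \<in> \<Delta>"
    by (rule sum.mono_neutral_left) (use assms that in auto)
  then show ?thesis
    by (auto simp: realization_carrier_def)
qed

lemma realization_carrier_deletion:
  "realization_carrier (deletion \<Delta> v) = {x \<in> realization_carrier \<Delta>. x v = 0}"
  by (auto simp: realization_carrier_def deletion_def)

text \<open>
  Since \<open>\<sigma> \<union> {v} = \<sigma>\<close> is a face, \<open>\<sigma>\<close> does not lie in the larger of the two families, hence not in
  the smaller one.
\<close>

lemma insert_face_if_non_extending_subset:
  assumes "non_extending_faces \<Delta> u \<subseteq> non_extending_faces \<Delta> v" "\<sigma> \<in> \<Delta>" "v \<in> \<sigma>"
  shows "insert u \<sigma> \<in> \<Delta>"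
  using assms by (auto simp: non_extending_faces_def insert_absorb)

lemma transfer_0 [simp]: "transfer v u 0 x = x"
  by (simp add: transfer_def)

lemma transfer_fixed: "x v = 0 \<Longrightarrow> transfer v u t x = x"
  by (simp add: transfer_def)

lemma transfer_1_vanishes: "u \<noteq> v \<Longrightarrow> transfer v u 1 x v = 0"
  by (simp add: transfer_def)

lemma sum_transfer:
  assumes "finite V" "u \<in> V" "v \<in> V"
  shows "sum (transfer v u t x) V = sum x V"
  using assms
  by (simp add: transfer_def sum.distrib sum_subtractf of_bool_def flip: sum_distrib_left)

lemma transfer_nonneg:
  assumes "\<And>i. 0 \<le> x i" "0 \<le> t" "t \<le> 1"
  shows "0 \<le> transfer v u t x i"
proof -
  have "t * x v \<le> x v" "0 \<le> t * x v"
    using assms by (simp_all add: mult_left_le_one_le)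
  then show ?thesis
    using assms(1)[of i] by (auto simp: transfer_def)
qed

text \<open>
  Only a point with weight at \<open>v\<close> moves, and its support \<open>\<sigma>\<close> contains \<open>v\<close>; all its positions have
  support inside the face \<open>insert u \<sigma>\<close>.
\<close>

lemma transfer_mem_carrier:
  assumes "abstract_simplicial_complex V \<Delta>" "u \<in> V" "v \<in> V"
    and ext: "\<And>\<sigma>. \<sigma> \<in> \<Delta> \<Longrightarrow> v \<in> \<sigma> \<Longrightarrow> insert u \<sigma> \<in> \<Delta>"
    and x: "x \<in> realization_carrier \<Delta>" and t: "0 \<le> t" "t \<le> 1"
  shows "transfer v u t x \<in> realization_carrier \<Delta>"
proof (cases "x v = 0")
  case True
  then show ?thesis
    using x by (simp add: transfer_fixed)
next
  case False
  have fin: "finite V" and sub: "\<And>\<sigma>. \<sigma> \<in> \<Delta> \<Longrightarrow> \<sigma> \<subseteq> V"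
    and down: "\<And>\<sigma> \<tau>. \<sigma> \<in> \<Delta> \<Longrightarrow> \<tau> \<subseteq> \<sigma> \<Longrightarrow> \<tau> \<in> \<Delta>"
    using assms(1) by (auto simp: abstract_simplicial_complex_def)
  note carrier_iff = realization_carrier_iff[OF fin sub]
  have x': "\<And>i. 0 \<le> x i" "{i. x i \<noteq> 0} \<in> \<Delta>" "sum x V = 1"
    using x by (auto simp: carrier_iff)
  have "insert u {i. x i \<noteq> 0} \<in> \<Delta>"
    using ext x'(2) False by simp
  moreover have "{i. transfer v u t x i \<noteq> 0} \<subseteq> insert u {i. x i \<noteq> 0}"
    using False by (auto simp: transfer_def)
  ultimately have "{i. transfer v u t x i \<noteq> 0} \<in> \<Delta>"
    by (rule down)
  then show ?thesis
    using x' t fin assms(2,3) by (simp add: carrier_iff sum_transfer transfer_nonneg)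
qed

lemma continuous_map_transfer:
  assumes "continuous_map X euclideanreal f" "continuous_map X (powertop_real UNIV) g"
  shows "continuous_map X (powertop_real UNIV) (\<lambda>z. transfer v u (f z) (g z))"
proof -
  have coord: "continuous_map X euclideanreal (\<lambda>z. g z i)" for i
    using assms(2) by (simp add: continuous_map_componentwise_UNIV)
  show ?thesis
    unfolding continuous_map_componentwise_UNIV transfer_def
    by (intro allI continuous_intros assms(1) coord)
qed

theorem theorem3p1:
  fixes V :: "'a set" and \<Delta> :: "'a set set" and u v :: 'a
  assumes "abstract_simplicial_complex V \<Delta>"
    and "u \<in> V" and "v \<in> V" and "u \<noteq> v"
    and "non_extending_faces \<Delta> u \<subseteq> non_extending_faces \<Delta> v"
  shows "geometric_realization \<Delta> homotopy_equivalent_space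
           geometric_realization (deletion \<Delta> v)"
proof -
  let ?X = "geometric_realization \<Delta>" and ?Y = "geometric_realization (deletion \<Delta> v)"
  let ?P = "prod_topology (top_of_set {0..1::real}) ?X"
  have mem: "transfer v u t x \<in> realization_carrier \<Delta>"
    if "x \<in> realization_carrier \<Delta>" "0 \<le> t" "t \<le> 1" for t x
    using transfer_mem_carrier[OF assms(1-3) insert_face_if_non_extending_subset[OF assms(5)] that] .
  have incl: "continuous_map ?X (powertop_real UNIV) (\<lambda>x. x)"
    unfolding geometric_realization_eq by (rule continuous_map_from_subtopology) simp

  have "continuous_map ?X (powertop_real UNIV) (transfer v u 1)"
    using continuous_map_transfer[OF _ incl, of "\<lambda>_. 1"] by simp
  then have retr: "continuous_map ?X ?Y (transfer v u 1)"
    unfolding geometric_realization_eq[of "deletion \<Delta> v"] continuous_map_in_subtopology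
    using mem transfer_1_vanishes[OF assms(4)] by (auto simp: realization_carrier_deletion)
  have "continuous_map ?Y ?X id"
    unfolding geometric_realization_eq
    by (auto simp: continuous_map_in_subtopology realization_carrier_deletion
        intro: continuous_map_from_subtopology)
  with retr have maps: "retraction_maps ?X ?Y (transfer v u 1) id"
    by (simp add: retraction_maps_def realization_carrier_deletion transfer_fixed)

  have "continuous_map ?P (powertop_real UNIV) (\<lambda>z. transfer v u (fst z) (snd z))"
  proof (rule continuous_map_transfer)
    show "continuous_map ?P euclideanreal fst"
      by (rule continuous_map_into_fulltopology[OF continuous_map_fst])
    show "continuous_map ?P (powertop_real UNIV) snd"
      using continuous_map_compose[OF continuous_map_snd incl] by (simp add: comp_def)
  qed
  then have "continuous_map ?P ?X (\<lambda>z. transfer v u (fst z) (snd z))"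
    using mem
    by (auto simp: geometric_realization_eq[of \<Delta>] continuous_map_in_subtopology)
  then have "homotopic_with (\<lambda>_. True) ?X ?X id (transfer v u 1)"
    unfolding homotopic_with_def
    by (intro exI[of _ "\<lambda>z. transfer v u (fst z) (snd z)"]) simp
  then have "homotopic_with (\<lambda>_. True) ?X ?X (id \<circ> transfer v u 1) id"
    by (simp add: homotopic_with_sym)
  then show ?thesis
    using maps by (rule deformation_retraction_imp_homotopy_equivalent_space)
qed

end
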